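(* Let $S$ be a numerical monoid, let $a\in S$ with $a\ne0$, and let $A=\{0,a\}$. Then $\omega\big(\mathcal P_{\mathrm{fin}}(S),A\big)=\omega\big(\mathcal P_{\mathrm{fin},0}(S),A\big)=\infty$.
   Context: A numerical monoid is an additive submonoid $S\subset\mathbb N_0$ with $\gcd(S)=1$. $\mathcal P_{\mathrm{fin}}(S)$ is the monoid of finite nonempty subsets of $S$ under set addition $X+Y=\{x+y\colon x\in X,y\in Y\}$, and $\mathcal P_{\mathrm{fin},0}(S)$ is its submonoid of sets containing $0$. In a monoid $H$, $X$ divides $Y$ if $Y=X+Z$ for some $Z\in H$. For $X\in H$, $\omega(H,X)$ is the smallest $N\in\mathbb N_0\cup\{\infty\}$ such that for all $n\in\mathbb N$ and $X_1,\dots,X_n\in H$, if $X$ divides $X_1+\dots+X_n$, then there is $\Omega\subset[1,n]$ with $|\Omega|\le N$ such that $X$ divides $\sum_{\lambda\in\Omega}X_\lambda$. *)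

theory Defs
  imports "HOL-Algebra.Divisibility" "HOL-Algebra.FiniteProduct" "HOL-Library.Set_Algebras" "HOL-Library.Extended_Nat"
begin

text \<open>
  HOL-Algebra writes monoids multiplicatively, so for the additive monoids below \<open>\<otimes>\<close> is
  \<open>+\<close>, \<open>\<one>\<close> is \<open>0\<close>, \<open>divides\<close> is divisibility with the cofactor taken from the carrier,
  and \<open>finprod\<close> is a finite sum.  On sets, \<open>+\<close> and \<open>0\<close> are the ones of
  \<open>Set_Algebras\<close>, i.e. the set of all sums \<open>x + y\<close> and \<open>{0}\<close>.
\<close>

definition additive_monoid :: "'a::comm_monoid_add set \<Rightarrow> 'a monoid" where
  "additive_monoid M = \<lparr>carrier = M, mult = (+), one = 0\<rparr>"

definition numerical_monoid :: "nat set \<Rightarrow> bool" where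
  "numerical_monoid S \<longleftrightarrow> submonoid S (additive_monoid UNIV) \<and> Gcd S = 1"

definition P_fin :: "nat set \<Rightarrow> nat set monoid" where
  "P_fin S = additive_monoid {X. X \<subseteq> S \<and> finite X \<and> X \<noteq> {}}"

definition P_fin0 :: "nat set \<Rightarrow> nat set monoid" where
  "P_fin0 S = additive_monoid {X. X \<subseteq> S \<and> finite X \<and> 0 \<in> X}"

text \<open>
  The least element exists because \<open>enat\<close> is well-ordered and \<open>\<infinity>\<close> always satisfies the
  condition.  The definition is meant for commutative monoids, where \<open>finprod\<close> is meaningful.
\<close>

definition omega :: "('a, 'b) monoid_scheme \<Rightarrow> 'a \<Rightarrow> enat" where
  "omega H x = (LEAST N. \<forall>n\<ge>1. \<forall>y \<in> {1..n::nat} \<rightarrow> carrier H.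
     x divides\<^bsub>H\<^esub> finprod H y {1..n} \<longrightarrow>
     (\<exists>\<Omega>\<subseteq>{1..n}. enat (card \<Omega>) \<le> N \<and> x divides\<^bsub>H\<^esub> finprod H y \<Omega>))"

lemma numerical_monoid_iff:
  "numerical_monoid S \<longleftrightarrow> 0 \<in> S \<and> (\<forall>x\<in>S. \<forall>y\<in>S. x + y \<in> S) \<and> Gcd S = 1"
  by (auto simp: numerical_monoid_def additive_monoid_def submonoid_def)

lemma comm_monoid_P_fin:
  assumes "numerical_monoid S"
  shows "comm_monoid (P_fin S)"
proof (rule comm_monoidI)
  fix X Y assume "X \<in> carrier (P_fin S)" "Y \<in> carrier (P_fin S)"
  then show "X \<otimes>\<^bsub>P_fin S\<^esub> Y \<in> carrier (P_fin S)"
    using assms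
    by (auto simp: P_fin_def additive_monoid_def numerical_monoid_iff finite_set_plus
        elim!: set_plus_elim)
qed (use assms in \<open>auto simp: P_fin_def additive_monoid_def numerical_monoid_iff
  add_ac\<close>)

lemma submonoid_P_fin0:
  assumes "numerical_monoid S"
  shows "submonoid (carrier (P_fin0 S)) (P_fin S)"
proof
  fix X Y assume "X \<in> carrier (P_fin0 S)" "Y \<in> carrier (P_fin0 S)"
  then show "X \<otimes>\<^bsub>P_fin S\<^esub> Y \<in> carrier (P_fin0 S)"
    using assms set_plus_intro[of 0 X 0 Y]
    by (auto simp: P_fin_def P_fin0_def additive_monoid_def numerical_monoid_iff finite_set_plus
        elim!: set_plus_elim)
qed (use assms in \<open>auto simp: P_fin_def P_fin0_def additive_monoid_def numerical_monoid_iff\<close>)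

lemma comm_monoid_P_fin0:
  assumes "numerical_monoid S"
  shows "comm_monoid (P_fin0 S)"
proof -
  have "P_fin0 S = P_fin S\<lparr>carrier := carrier (P_fin0 S)\<rparr>"
    by (simp add: P_fin_def P_fin0_def additive_monoid_def)
  then show ?thesis
    using comm_monoid.submonoid_is_comm_monoid comm_monoid_P_fin submonoid_P_fin0 assms by metis
qed

end

theory Submission
  imports Defs
begin

text \<open>
  The set \<open>{0, a}\<close> divides \<open>Y\<close> iff every element of \<open>Y\<close> has a neighbour at distance \<open>a\<close> in \<open>Y\<close>.
  Given \<open>N\<close>, put \<open>m = 3N + 3\<close> and \<open>X = a \<cdot> {0, 1, 3, m - 1, m}\<close>.  In a \<open>k\<close>-fold sum
  one can replace a summand \<open>0\<close> by \<open>a\<close> or \<open>(m - 1)a\<close> by \<open>ma\<close>, and conversely, so \<open>3ka\<close> is the only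
  element of \<open>kX\<close> that can be isolated.  It is isolated for \<open>k \<le> N\<close>, since \<open>m\<close> is large, but
  not for \<open>k = m\<close>, since then \<open>3ka = ma + ma + ma\<close> has the neighbour \<open>ma + ma + (m - 1)a\<close>.
\<close>

text \<open>Take all summands equal to one \<open>y\<close>: a subsum then depends only on the size
  of its index set, so a finite value \<open>N\<close> of \<open>omega\<close> would force
  \<open>x\<close> to divide some \<open>y [^] k\<close> with k \<le> N.\<close>

lemma omega_eq_infinityI:
  fixes H (structure)
  assumes H: "comm_monoid H"
    and ex: "\<And>N::nat. \<exists>y\<in>carrier H. \<exists>n::nat\<ge>1. x divides y [^] n \<and> (\<forall>k\<le>N. \<not> x divides y [^] k)"
  shows "omega H x = \<infinity>"
proof (rule ccontr)
  interpret comm_monoid H by (rule H)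
  let ?P = "\<lambda>N. \<forall>n\<ge>1. \<forall>y \<in> {1..n::nat} \<rightarrow> carrier H. x divides finprod H y {1..n} \<longrightarrow>
     (\<exists>\<Omega>\<subseteq>{1..n}. enat (card \<Omega>) \<le> N \<and> x divides finprod H y \<Omega>)"
  assume "omega H x \<noteq> \<infinity>"
  then obtain N where N: "omega H x = enat N" by auto
  \<comment> \<open>The full index set is always admissible here, so the least bound is
    attained.\<close>
  have "?P \<infinity>" by auto
  then have "?P (omega H x)"
    unfolding omega_def by (rule LeastI)
  then have P: "?P (enat N)"
    unfolding N .
  obtain y and n :: nat where y: "y \<in> carrier H" "n \<ge> 1" "x divides y [^] n"
      and no: "\<And>k. k \<le> N \<Longrightarrow> \<not> x divides y [^] k"
    using ex[of N] by blast
  have const: "finprod H (\<lambda>_. y) B = y [^] card B" for B :: "nat set"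
    using y(1) by (rule finprod_const)
  have "(\<lambda>_. y) \<in> {1..n} \<rightarrow> carrier H"
    using y(1) by simp
  moreover have "x divides finprod H (\<lambda>_. y) {1..n}"
    using y(3) by (simp add: const)
  ultimately obtain B :: "nat set" where "enat (card B) \<le> enat N" "x divides finprod H (\<lambda>_. y) B"
    using P y(2) by blast
  then show False
    using no[of "card B"] by (simp add: const)
qed

lemma additive_monoid_simps [simp]:
  "carrier (additive_monoid M) = M"
  "x \<otimes>\<^bsub>additive_monoid M\<^esub> y = x + y"
  "\<one>\<^bsub>additive_monoid M\<^esub> = 0"
  by (simp_all add: additive_monoid_def)

lemma additive_monoid_pow_0 [simp]: "x [^]\<^bsub>additive_monoid M\<^esub> (0::nat) = 0"
  by (simp add: nat_pow_def)

lemma additive_monoid_pow_Suc [simp]: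
  "x [^]\<^bsub>additive_monoid M\<^esub> Suc k = x [^]\<^bsub>additive_monoid M\<^esub> k + x"
  by (simp add: nat_pow_def)

lemma pair_plus: "{0, a} + Z = Z \<union> (\<lambda>z. z + a) ` Z" for a :: "'a::comm_monoid_add"
  by (auto simp: set_plus_def add.commute)

definition has_neighbour :: "nat \<Rightarrow> nat set \<Rightarrow> nat \<Rightarrow> bool" where
  "has_neighbour a Y y \<longleftrightarrow> y + a \<in> Y \<or> (\<exists>z\<in>Y. y = z + a)"

lemma has_neighbour_plus:
  assumes "has_neighbour a Y y" "x \<in> X"
  shows "has_neighbour a (Y + X) (y + x)"
  using assms set_plus_intro[of "y + a" Y x X] set_plus_intro[of _ Y x X]
  by (fastforce simp: has_neighbour_def add_ac)

lemma pair_plus_has_neighbour: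
  assumes "y \<in> {0, a} + Z"
  shows "has_neighbour a ({0, a} + Z) y"
  using assms by (auto simp: pair_plus has_neighbour_def)

text \<open>The cofactor collects the lower ends of all pairs at distance \<open>a\<close> in
  \<open>Y\<close>; every element of \<open>Y\<close> is the lower or the upper end of such a
  pair.\<close>

lemma pair_plus_eqI:
  assumes "\<And>y. y \<in> Y \<Longrightarrow> has_neighbour a Y y"
  shows "{0, a} + {z \<in> Y. z + a \<in> Y} = Y"
  using assms by (fastforce simp: pair_plus has_neighbour_def)

definition spread_set :: "nat \<Rightarrow> nat \<Rightarrow> nat set" where
  "spread_set a N = {0, a, 3 * a, (3 * N + 2) * a, (3 * N + 3) * a}"

context
  fixes a N :: nat and M :: "nat set set"
begin

text \<open>Powers do not depend on the carrier, so \<open>M\<close> stays arbitrary and the facts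
  below serve both monoids.\<close>

abbreviation multiple :: "nat \<Rightarrow> nat set" where
  "multiple k \<equiv> spread_set a N [^]\<^bsub>additive_monoid M\<^esub> k"

text \<open>One large summand already gives 3 * N + 2 \<le> t. Without one, all coefficients are at
  most 3, and each \<open>0\<close> or \<open>1\<close> in place of a \<open>3\<close> loses at
  least 2.\<close>

lemma multiple_mem_shape:
  assumes "y \<in> multiple k"
  shows "\<exists>t. y = t * a \<and> (t + 2 \<le> 3 * k \<or> t = 3 * k \<or> 3 * N + 2 \<le> t)"
  using assms
proof (induction k arbitrary: y)
  case (Suc k)
  then obtain u x where "u \<in> multiple k" and x: "x \<in> spread_set a N" and y: "y = u + x"
    by (auto elim: set_plus_elim)
  then obtain t where t: "u = t * a" "t + 2 \<le> 3 * k \<or> t = 3 * k \<or> 3 * N + 2 \<le> t"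
    using Suc.IH by blast
  from x obtain b where b: "x = b * a" "b \<in> {0, 1, 3, 3 * N + 2, 3 * N + 3}"
    unfolding spread_set_def by force
  have "y = (t + b) * a"
    by (simp add: y t(1) b(1) algebra_simps)
  moreover have "t + b + 2 \<le> 3 * Suc k \<or> t + b = 3 * Suc k \<or> 3 * N + 2 \<le> t + b"
    using t(2) b(2) by auto
  ultimately show ?case by blast
qed (auto intro: exI[of _ 0])

lemma three_mem_multiple: "3 * k * a \<in> multiple k"
proof (induction k)
  case (Suc k)
  then have "3 * k * a + 3 * a \<in> multiple k + spread_set a N"
    by (intro set_plus_intro) (auto simp: spread_set_def)
  then show ?case by (simp add: algebra_simps)
qed simp

text \<open>The coefficients 3 * k - 1 and 3 * k + 1 fall into the gaps around 3 * k, the upper one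
  because 3 * k + 1 < 3 * N + 2.\<close>

lemma three_isolated:
  assumes "a \<noteq> 0" "k \<le> N"
  shows "\<not> has_neighbour a (multiple k) (3 * k * a)"
proof
  assume "has_neighbour a (multiple k) (3 * k * a)"
  then obtain y where "y \<in> multiple k" and y: "y = (3 * k + 1) * a \<or> y + a = 3 * k * a"
    by (auto simp: has_neighbour_def add.commute)
  then obtain t where t: "y = t * a" "t + 2 \<le> 3 * k \<or> t = 3 * k \<or> 3 * N + 2 \<le> t"
    using multiple_mem_shape by blast
  from y have "t * a = (3 * k + 1) * a \<or> (t + 1) * a = 3 * k * a"
    by (auto simp: t(1) algebra_simps)
  then have "t = 3 * k + 1 \<or> t + 1 = 3 * k"
    using assms(1) by (metis mult_cancel2)
  with t(2) assms(2) show False by linarith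
qed

lemma multiple_has_neighbour:
  assumes "y \<in> multiple k" "y \<noteq> 3 * k * a"
  shows "has_neighbour a (multiple k) y"
  using assms
proof (induction k arbitrary: y)
  case (Suc k)
  then obtain u x where u: "u \<in> multiple k" and x: "x \<in> spread_set a N" and y: "y = u + x"
    by (auto elim: set_plus_elim)
  show ?case
  proof (cases "u = 3 * k * a")
    case True
    \<comment> \<open>Now the last summand can be moved by \<open>a\<close> within
      \<open>spread_set a N\<close>; in the other case the neighbour of \<open>u\<close> is
      translated by \<open>x\<close>.\<close>
    then have "x \<noteq> 3 * a"
      using Suc.prems(2) y by (auto simp: algebra_simps)
    then have "has_neighbour a (spread_set a N) x"
      using x by (auto simp: has_neighbour_def spread_set_def algebra_simps)
    from has_neighbour_plus[OF this u] show ?thesis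
      by (simp add: y add.commute)
  next
    case False
    then show ?thesis
      using has_neighbour_plus[OF Suc.IH[OF u] x] by (simp add: y)
  qed
qed simp

text \<open>Further summands can be taken to be \<open>0\<close>.\<close>

lemma multiple_mono: "k \<le> l \<Longrightarrow> multiple k \<subseteq> multiple l"
proof (rule lift_Suc_mono_le[of multiple])
  fix n
  show "multiple n \<subseteq> multiple (Suc n)"
    using set_plus_intro[of _ "multiple n" 0 "spread_set a N"] by (auto simp: spread_set_def)
qed

lemma last_multiple_has_neighbour:
  assumes "y \<in> multiple (3 * N + 3)"
  shows "has_neighbour a (multiple (3 * N + 3)) y"
proof (cases "y = 3 * (3 * N + 3) * a")
  case True
  let ?m = "3 * N + 3"
  \<comment> \<open>This is the lower neighbour of 3 * ?m * a. The leading \<open>0\<close> is the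
    element of the zeroth power.\<close>
  have "0 + ?m * a + ?m * a + (3 * N + 2) * a \<in> multiple (Suc (Suc (Suc 0)))"
    unfolding additive_monoid_pow_Suc
    by (intro set_plus_intro) (auto simp: spread_set_def)
  also have "\<dots> \<subseteq> multiple ?m"
    by (rule multiple_mono) simp
  finally show ?thesis
    unfolding has_neighbour_def
    by (intro disjI2 bexI) (auto simp: True algebra_simps)
qed (use assms multiple_has_neighbour in blast)

end

text \<open>The two monoids differ only in whether the cofactor of lower ends stays in the carrier;
  \<open>closed\<close> isolates this.\<close>

lemma omega_pair_eq_infinity:
  fixes a :: nat and M :: "nat set set"
  assumes M: "comm_monoid (additive_monoid M)"
    and "a \<noteq> 0"
    and spread: "\<And>N. spread_set a N \<in> M"
    and closed: "\<And>Y. Y \<in> M \<Longrightarrow> (\<And>y. y \<in> Y \<Longrightarrow> has_neighbour a Y y) \<Longrightarrow> {z \<in> Y. z + a \<in> Y} \<in> M"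
  shows "omega (additive_monoid M) {0, a} = \<infinity>"
proof (rule omega_eq_infinityI[OF M])
  interpret comm_monoid "additive_monoid M" by (rule M)
  fix N
  let ?kX = "\<lambda>k::nat. spread_set a N [^]\<^bsub>additive_monoid M\<^esub> k"
  have "?kX (3 * N + 3) \<in> M"
    using nat_pow_closed[of "spread_set a N"] spread by simp
  then have "{0, a} divides\<^bsub>additive_monoid M\<^esub> ?kX (3 * N + 3)"
    unfolding factor_def
    using closed pair_plus_eqI last_multiple_has_neighbour
    by (intro bexI[of _ "{z \<in> ?kX (3 * N + 3). z + a \<in> ?kX (3 * N + 3)}"]) simp_all
  moreover have "\<not> {0, a} divides\<^bsub>additive_monoid M\<^esub> ?kX k" if "k \<le> N" for k
  proof
    assume "{0, a} divides\<^bsub>additive_monoid M\<^esub> ?kX k"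
    then obtain Z where "?kX k = {0, a} + Z"
      by (auto simp: factor_def)
    then have "has_neighbour a (?kX k) (3 * k * a)"
      using pair_plus_has_neighbour three_mem_multiple by metis
    with three_isolated \<open>a \<noteq> 0\<close> that show False by blast
  qed
  ultimately show "\<exists>y\<in>carrier (additive_monoid M). \<exists>n::nat\<ge>1.
      {0, a} divides\<^bsub>additive_monoid M\<^esub> y [^]\<^bsub>additive_monoid M\<^esub> n \<and>
      (\<forall>k\<le>N. \<not> {0, a} divides\<^bsub>additive_monoid M\<^esub> y [^]\<^bsub>additive_monoid M\<^esub> k)"
    using spread[of N]
    by (intro bexI[of _ "spread_set a N"] exI[of _ "3 * N + 3"] conjI allI impI) simp_all
qed

lemma numerical_monoid_mult_mem:
  assumes "numerical_monoid S" "a \<in> S"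
  shows "t * a \<in> S"
  using assms by (induction t) (auto simp: numerical_monoid_iff)

theorem theorem5p1:
  fixes S :: "nat set" and a :: nat and A :: "nat set"
  assumes "numerical_monoid S"
    and "a \<in> S"
    and "a \<noteq> 0"
    and "A = {0, a}"
  shows "omega (P_fin S) A = \<infinity> \<and> omega (P_fin0 S) A = \<infinity>"
proof -
  have spread: "spread_set a N \<subseteq> S" for N
    using numerical_monoid_mult_mem[OF assms(1,2)] assms(1,2)
    by (auto simp: spread_set_def numerical_monoid_iff simp del: mult_Suc)
  have "omega (P_fin S) {0, a} = \<infinity>"
    unfolding P_fin_def
  proof (rule omega_pair_eq_infinity)
    show "comm_monoid (additive_monoid {X. X \<subseteq> S \<and> finite X \<and> X \<noteq> {}})"
      using comm_monoid_P_fin[OF assms(1)] by (simp add: P_fin_def)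
    show "spread_set a N \<in> {X. X \<subseteq> S \<and> finite X \<and> X \<noteq> {}}" for N
      using spread[of N] by (auto simp: spread_set_def)
  \<comment> \<open>Any element of \<open>Y\<close> together with its neighbour yields a lower end,
    so the cofactor is nonempty.\<close>
  qed (use assms(3) in \<open>auto simp: has_neighbour_def\<close>)
  moreover have "omega (P_fin0 S) {0, a} = \<infinity>"
    unfolding P_fin0_def
  proof (rule omega_pair_eq_infinity)
    show "comm_monoid (additive_monoid {X. X \<subseteq> S \<and> finite X \<and> 0 \<in> X})"
      using comm_monoid_P_fin0[OF assms(1)] by (simp add: P_fin0_def)
    show "spread_set a N \<in> {X. X \<subseteq> S \<and> finite X \<and> 0 \<in> X}" for N
      using spread[of N] by (auto simp: spread_set_def)
  \<comment> \<open>As a \<noteq> 0, the neighbour of \<open>0\<close> can only be \<open>a\<close>,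
    so \<open>0\<close> is a lower end and lies in the cofactor.\<close>
  qed (use assms(3) in \<open>force simp: has_neighbour_def\<close>)+
  ultimately show ?thesis
    by (simp add: assms(4))
qed

end
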